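(* Let $k\in\mathbb N_0$, $0<\alpha<1$ and $f\in\mathcal C^{k,\alpha}(\mathbb S^2)$. Then the DFS function $\tilde f$ of $f$ belongs to $\mathcal C^{k,\alpha}(\mathbb T^2)$, and $$|\tilde f|_{\mathcal C^{k,\alpha}(\mathbb T^2)}\le(k+3)!\,\|f\|_{\mathcal C^{k,\alpha}(\mathbb S^2)},\qquad \|\tilde f\|_{\mathcal C^{k,\alpha}(\mathbb T^2)}\le\tfrac74(k+3)!\,\|f\|_{\mathcal C^{k,\alpha}(\mathbb S^2)}.$$
   Context: Notation: $\|\cdot\|$ Euclidean norm; $B^d_k:=\{\beta\in\mathbb N_0^d: |\beta|=\sum_i\beta_i\le k\}$. Spaces on open $U\subset\mathbb R^d$: $\mathcal C(U)$ is the set of bounded uniformly continuous $f\colon U\to\mathbb C$; for $k\ge1$, $\mathcal C^k(U)$ consists of $f$ whose classical partial derivatives $D^\beta f$, $\beta\in B^d_k$, exist and lie in $\mathcal C(U)$, with $\|f\|_{\mathcal C^k(U)}=\sum_{\beta\in B^d_k}\sup_U|D^\beta f|$. For $0<\alpha<1$, $|f|_{\mathcal C^{k,\alpha}(U)}:=\sup\{|D^\beta f(x)-D^\beta f(y)|/\|x-y\|^\alpha: x\ne y\in U,\ |\beta|=k\}$, $\mathcal C^{k,\alpha}(U)=\{f\in\mathcal C^k(U): |f|_{\mathcal C^{k,\alpha}(U)}<\infty\}$ with $\|f\|_{\mathcal C^{k,\alpha}(U)}=\|f\|_{\mathcal C^k(U)}+|f|_{\mathcal C^{k,\alpha}(U)}$.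 Torus: $\mathbb T^2=\mathbb R^2/(2\pi\mathbb Z^2)$; functions identified with $2\pi$-biperiodic functions on $\mathbb R^2$; $\mathcal C^{k,\alpha}(\mathbb T^2)$ is the set of $2\pi$-biperiodic elements of $\mathcal C^{k,\alpha}(\mathbb R^2)$ with the same (semi)norms. Sphere: $\mathbb S^2=\{x\in\mathbb R^3:\|x\|=1\}$. For $f\colon\mathbb S^2\to\mathbb C$, a $\mathcal C^{k,\alpha}$-extension of $f$ is some $f^*\in\mathcal C^{k,\alpha}(U)$, $U\supset\mathbb S^2$ open, with $f^*|_{\mathbb S^2}=f$. Set $|f^*|^*_{\mathcal C^{k,\alpha}(\mathbb S^2)}:=\sum_{\beta\in B^3_k}\sup_{\xi\in\mathbb S^2}|D^\beta f^*(\xi)|+\sup\{|D^\beta f^*(\xi)-D^\beta f^*(\eta)|/\|\xi-\eta\|^\alpha:\ \xi\ne\eta\in\mathbb S^2,\ |\beta|=k\}$, $\|f\|_{\mathcal C^{k,\alpha}(\mathbb S^2)}:=\inf$ of $|f^*|^*_{\mathcal C^{k,\alpha}(\mathbb S^2)}$ over all $\mathcal C^{k,\alpha}$-extensions, and $\mathcal C^{k,\alpha}(\mathbb S^2)$ is the set of $f$ with finite norm. DFS: $\phi(\lambda,\theta)=(\cos\lambda\sin\theta,\sin\lambda\sin\theta,\cos\theta)$; the DFS function of $f$ is $\tilde f:=f\circ\phi\colon\mathbb T^2\to\mathbb C$. *)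

theory Defs
  imports "HOL-Analysis.Analysis" "HOL-Library.Numeral_Type"
begin

text \<open>Classical partial derivative in coordinate direction i (value meaningful where it exists).\<close>
definition partial :: "'n::finite \<Rightarrow> (real^'n \<Rightarrow> complex) \<Rightarrow> real^'n \<Rightarrow> complex" where
  "partial i f x = vector_derivative (\<lambda>t. f (x + t *\<^sub>R axis i 1)) (at 0)"

definition has_partial :: "'n::finite \<Rightarrow> (real^'n \<Rightarrow> complex) \<Rightarrow> real^'n \<Rightarrow> bool" where
  "has_partial i f x \<longleftrightarrow> (\<lambda>t. f (x + t *\<^sub>R axis i 1)) differentiable (at 0)"

fun pd :: "'n::finite list \<Rightarrow> (real^'n \<Rightarrow> complex) \<Rightarrow> real^'n \<Rightarrow> complex" where
  "pd [] f = f"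
| "pd (i # is) f = partial i (pd is f)"

definition mi_list :: "(('n::{finite,linorder}) \<Rightarrow> nat) \<Rightarrow> 'n list" where
  "mi_list \<beta> = concat (map (\<lambda>i. replicate (\<beta> i) i) (sorted_list_of_set UNIV))"

definition D :: "('n \<Rightarrow> nat) \<Rightarrow> ((real, 'n::{finite,linorder}) vec \<Rightarrow> complex) \<Rightarrow> (real, 'n) vec \<Rightarrow> complex" where
  "D \<beta> f = pd (mi_list \<beta>) f"

definition mi_order :: "(('n::finite) \<Rightarrow> nat) \<Rightarrow> nat" where
  "mi_order \<beta> = (\<Sum>i\<in>UNIV. \<beta> i)"

definition B :: "nat \<Rightarrow> (('n::finite) \<Rightarrow> nat) set" where
  "B k = {\<beta>. mi_order \<beta> \<le> k}"

definition C0 :: "(real^'n::finite) set \<Rightarrow> (real^'n \<Rightarrow> complex) \<Rightarrow> bool" where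
  "C0 U f \<longleftrightarrow> bounded (f ` U) \<and> uniformly_continuous_on U f"

fun Ck :: "nat \<Rightarrow> (real^'n::finite) set \<Rightarrow> (real^'n \<Rightarrow> complex) \<Rightarrow> bool" where
  "Ck 0 U f \<longleftrightarrow> C0 U f"
| "Ck (Suc k) U f \<longleftrightarrow> C0 U f \<and> (\<forall>i. (\<forall>x\<in>U. has_partial i f x) \<and> Ck k U (partial i f))"

definition holder_quots :: "nat \<Rightarrow> real \<Rightarrow> ((real, 'n::{finite,linorder}) vec) set \<Rightarrow> ((real, 'n) vec \<Rightarrow> complex) \<Rightarrow> real set" where
  "holder_quots k \<alpha> S f = {cmod (D \<beta> f x - D \<beta> f y) / norm (x - y) powr \<alpha> | \<beta> x y.
      mi_order \<beta> = k \<and> x \<in> S \<and> y \<in> S \<and> x \<noteq> y}"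

definition holder_semi :: "nat \<Rightarrow> real \<Rightarrow> ((real, 'n::{finite,linorder}) vec) set \<Rightarrow> ((real, 'n) vec \<Rightarrow> complex) \<Rightarrow> real" where
  "holder_semi k \<alpha> S f = Sup (holder_quots k \<alpha> S f)"

definition sup_part :: "nat \<Rightarrow> ((real, 'n::{finite,linorder}) vec) set \<Rightarrow> ((real, 'n) vec \<Rightarrow> complex) \<Rightarrow> real" where
  "sup_part k S f = (\<Sum>\<beta>\<in>B k. SUP x\<in>S. cmod (D \<beta> f x))"

definition holder_norm :: "nat \<Rightarrow> real \<Rightarrow> ((real, 'n::{finite,linorder}) vec) set \<Rightarrow> ((real, 'n) vec \<Rightarrow> complex) \<Rightarrow> real" where
  "holder_norm k \<alpha> S f = sup_part k S f + holder_semi k \<alpha> S f"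

definition Ckalpha :: "nat \<Rightarrow> real \<Rightarrow> ((real, 'n::{finite,linorder}) vec) set \<Rightarrow> ((real, 'n) vec \<Rightarrow> complex) \<Rightarrow> bool" where
  "Ckalpha k \<alpha> U f \<longleftrightarrow> Ck k U f \<and> bdd_above (holder_quots k \<alpha> U f)"

text \<open>Torus T^2 = R^2 / 2 pi Z^2: 2pi-biperiodic elements of C^{k,alpha}(R^2).\<close>
definition biperiodic :: "(real^2 \<Rightarrow> complex) \<Rightarrow> bool" where
  "biperiodic g \<longleftrightarrow> (\<forall>x. g (x + (2*pi) *\<^sub>R axis 1 1) = g x \<and> g (x + (2*pi) *\<^sub>R axis 2 1) = g x)"

definition torus_Ckalpha :: "nat \<Rightarrow> real \<Rightarrow> (real^2 \<Rightarrow> complex) \<Rightarrow> bool" where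
  "torus_Ckalpha k \<alpha> g \<longleftrightarrow> biperiodic g \<and> Ckalpha k \<alpha> UNIV g"

definition torus_semi :: "nat \<Rightarrow> real \<Rightarrow> (real^2 \<Rightarrow> complex) \<Rightarrow> real" where
  "torus_semi k \<alpha> g = holder_semi k \<alpha> UNIV g"

definition torus_norm :: "nat \<Rightarrow> real \<Rightarrow> (real^2 \<Rightarrow> complex) \<Rightarrow> real" where
  "torus_norm k \<alpha> g = holder_norm k \<alpha> UNIV g"

definition S2 :: "(real^3) set" where
  "S2 = {x. norm x = 1}"

definition is_extension :: "nat \<Rightarrow> real \<Rightarrow> (real^3 \<Rightarrow> complex) \<Rightarrow> (real^3) set \<Rightarrow> (real^3 \<Rightarrow> complex) \<Rightarrow> bool" where
  "is_extension k \<alpha> f U g \<longleftrightarrow> open U \<and> S2 \<subseteq> U \<and> Ckalpha k \<alpha> U g \<and> (\<forall>\<xi>\<in>S2. g \<xi> = f \<xi>)"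

definition sphere_norm :: "nat \<Rightarrow> real \<Rightarrow> (real^3 \<Rightarrow> complex) \<Rightarrow> real" where
  "sphere_norm k \<alpha> f = Inf {holder_norm k \<alpha> S2 g | U g. is_extension k \<alpha> f U g}"

text \<open>f in C^{k,alpha}(S^2) iff its norm is finite, i.e. iff some extension exists.\<close>
definition sphere_Ckalpha :: "nat \<Rightarrow> real \<Rightarrow> (real^3 \<Rightarrow> complex) \<Rightarrow> bool" where
  "sphere_Ckalpha k \<alpha> f \<longleftrightarrow> (\<exists>U g. is_extension k \<alpha> f U g)"

definition dfs_phi :: "real \<Rightarrow> real \<Rightarrow> real^3" where
  "dfs_phi lam \<theta> = vector [cos lam * sin \<theta>, sin lam * sin \<theta>, cos \<theta>]"

definition dfs :: "(real^3 \<Rightarrow> complex) \<Rightarrow> real^2 \<Rightarrow> complex" where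
  "dfs f p = f (dfs_phi (p $ 1) (p $ 2))"

end

theory Submission
  imports Defs
begin

text \<open>Let \<open>g\<close> be an extension of \<open>f\<close> and \<open>N\<close> its norm on the sphere. By induction, a partial
  derivative of order \<open>m\<close> of \<open>g \<circ> \<phi>\<close> is a sum of at most \<open>3 \<cdot> 4 \<cdots> (m + 2) = (m + 2)! / 2\<close> terms
  of the form \<open>(D\<^sup>\<gamma> g \<circ> \<phi>) \<cdot> c\<^sub>1 \<cdots> c\<^sub>j\<close> with \<open>|\<gamma>|, j \<le> m\<close>, where every \<open>c\<^sub>i\<close> is a product of a
  trigonometric function of the first and one of the second variable, with amplitude and
  frequencies at most \<open>1\<close>. Each \<open>c\<^sub>i\<close> is bounded by \<open>1\<close> and has Hoelder constant at most \<open>2\<close>, while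
  \<open>D\<^sup>\<gamma> g \<circ> \<phi>\<close> is bounded by \<open>N\<close> and has Hoelder constant at most \<open>6 N\<close>. So a term is bounded by \<open>N\<close>
  with Hoelder constant at most \<open>(6 + 2 m) N\<close>. For \<open>m = k\<close> this gives the seminorm bound
  \<open>(k + 3)! N\<close>, and summing the suprema over all multi-indices adds at most \<open>(k + 3)! N / 2\<close>.\<close>

section \<open>Partial derivatives\<close>

lemma has_partial_iff:
  "has_partial i f x \<longleftrightarrow> ((\<lambda>t. f (x + t *\<^sub>R axis i 1)) has_vector_derivative partial i f x) (at 0)"
  unfolding has_partial_def partial_def by (rule vector_derivative_works)

lemma has_partialI:
  assumes "(f has_derivative f') (at x)"
  shows "has_partial i f x" and "partial i f x = f' (axis i 1)"
proof -
  have "((\<lambda>t. f (x + t *\<^sub>R axis i 1)) has_derivative (\<lambda>t. f' (t *\<^sub>R axis i 1))) (at 0)"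
    by (rule has_derivative_compose[of "\<lambda>t. x + t *\<^sub>R axis i 1" _ _ _ f])
      (auto intro!: derivative_eq_intros assms)
  then have "((\<lambda>t. f (x + t *\<^sub>R axis i 1)) has_vector_derivative f' (axis i 1)) (at 0)"
    by (simp add: has_vector_derivative_def linear_scale[OF has_derivative_linear[OF assms]])
  then show "has_partial i f x" "partial i f x = f' (axis i 1)"
    by (auto simp: has_partial_def partial_def differentiableI_vector vector_derivative_at)
qed

text \<open>\<open>partial\<close> is a derivative at parameter \<open>0\<close>. Substituting
  \<open>t - s\<close> moves the base point, so mean value arguments can run along a whole
  segment.\<close>

lemma has_vector_derivative_along_axis:
  assumes "has_partial i f (x + s *\<^sub>R axis i 1)"
  shows "((\<lambda>t. f (x + t *\<^sub>R axis i 1)) has_vector_derivative partial i f (x + s *\<^sub>R axis i 1)) (at s)"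
proof -
  have "(((\<lambda>t. f (x + s *\<^sub>R axis i 1 + t *\<^sub>R axis i 1)) \<circ> (\<lambda>t. t - s))
      has_vector_derivative 1 *\<^sub>R partial i f (x + s *\<^sub>R axis i 1)) (at s)"
    by (rule vector_diff_chain_at)
      (use assms in \<open>auto simp: has_partial_iff intro!: derivative_eq_intros\<close>)
  then show ?thesis
    by (simp add: o_def algebra_simps)
qed

lemma eventually_line_in_open:
  fixes x v :: "'a::real_normed_vector"
  assumes "open U" "x \<in> U"
  shows "eventually (\<lambda>t. x + t *\<^sub>R v \<in> U) (nhds (0::real))"
proof -
  have "((\<lambda>t. x + t *\<^sub>R v) \<longlongrightarrow> x + 0 *\<^sub>R v) (nhds (0::real))"
    by (intro tendsto_intros) (simp add: filterlim_ident)
  then show ?thesis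
    using topological_tendstoD[of _ x "nhds 0" U] assms by simp
qed

lemma partial_cong:
  assumes "open U" "x \<in> U" "\<And>y. y \<in> U \<Longrightarrow> f y = g y"
  shows "partial i f x = partial i g x"
  unfolding partial_def
  by (rule vector_derivative_cong_eq)
    (auto intro: eventually_mono[OF eventually_line_in_open[OF assms(1,2)]] assms(3))

text \<open>Openness makes the agreement of \<open>f\<close> and \<open>g\<close> local around each
  point of \<open>U\<close>, so it survives every differentiation. This permits rewriting below an
  outer derivative.\<close>

lemma pd_cong:
  assumes "open U" "\<And>y. y \<in> U \<Longrightarrow> f y = g y" "x \<in> U"
  shows "pd l f x = pd l g x"
  using assms(3)
proof (induction l arbitrary: x)
  case (Cons i l)
  then show ?case
    by (auto intro!: partial_cong[OF assms(1)])
qed (use assms in simp)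

text \<open>Mean value inequality for \<open>f (x + t *\<^sub>R axis i 1) - t *\<^sub>R c\<close> as
  a function of \<open>t\<close>. It serves both total differentiability and mixed second
  differences.\<close>

lemma axis_increment_bound:
  assumes hp: "\<And>t. t \<in> closed_segment 0 s \<Longrightarrow> has_partial i f (x + t *\<^sub>R axis i 1)"
    and bd: "\<And>t. t \<in> closed_segment 0 s \<Longrightarrow> norm (partial i f (x + t *\<^sub>R axis i 1) - c) \<le> e"
  shows "norm (f (x + s *\<^sub>R axis i 1) - f x - s *\<^sub>R c) \<le> e * \<bar>s\<bar>"
proof -
  define h where "h t = f (x + t *\<^sub>R axis i 1) - t *\<^sub>R c" for t
  have "norm (h s - h 0) \<le> e * norm (s - 0)"
  proof (rule differentiable_bound[of "closed_segment 0 s"])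
    fix t assume t: "t \<in> closed_segment 0 s"
    have "(h has_vector_derivative (partial i f (x + t *\<^sub>R axis i 1) - 1 *\<^sub>R c)) (at t)"
      unfolding h_def
      by (intro has_vector_derivative_diff has_vector_derivative_along_axis[OF hp[OF t]])
        (auto intro!: derivative_eq_intros)
    then show "(h has_derivative (\<lambda>u. u *\<^sub>R (partial i f (x + t *\<^sub>R axis i 1) - c)))
        (at t within closed_segment 0 s)"
      by (simp add: has_vector_derivative_def has_derivative_at_withinI)
    show "onorm (\<lambda>u. u *\<^sub>R (partial i f (x + t *\<^sub>R axis i 1) - c)) \<le> e"
      using bd[OF t] by (intro onorm_le) (simp add: mult.commute[of e] mult_left_mono)
  qed auto
  then show ?thesis
    by (simp add: h_def algebra_simps)
qed

lemma closed_segment_0_abs_le: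
  fixes t s :: real
  assumes "t \<in> closed_segment 0 s"
  shows "\<bar>t\<bar> \<le> \<bar>s\<bar>"
  using assms by (auto simp: closed_segment_eq_real_ivl split: if_splits)

text \<open>The increment is made one coordinate at a time, each move being compared with the
  partial derivative at \<open>x\<close>. The chain rule for \<open>dfs\<close> needs this total
  derivative, while \<open>Ck\<close> only supplies partial ones.\<close>

lemma has_derivative_of_continuous_partials:
  fixes f :: "real^'n::finite \<Rightarrow> complex"
  assumes U: "open U" "x \<in> U"
    and hp: "\<And>i y. y \<in> U \<Longrightarrow> has_partial i f y"
    and ct: "\<And>i. continuous_on U (partial i f)"
  shows "(f has_derivative (\<lambda>h. \<Sum>i\<in>UNIV. (h $ i) *\<^sub>R partial i f x)) (at x)"
  unfolding has_derivative_at_alt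
proof (intro conjI allI impI)
  show "bounded_linear (\<lambda>h. \<Sum>i\<in>UNIV. (h $ i) *\<^sub>R partial i f x)"
    by (intro bounded_linear_sum bounded_linear_compose[OF bounded_linear_scaleR_left bounded_linear_vec_nth])
  fix e :: real assume "e > 0"
  \<comment> \<open>Each component of an increment is at most its norm, so the errors of all
    \<open>CARD('n)\<close> coordinates add up to at most \<open>e\<close> times the norm.\<close>
  define e' where "e' = e / real CARD('n)"
  have e': "e' > 0" using \<open>e > 0\<close> by (simp add: e'_def)
  have "eventually (\<lambda>y. y \<in> U \<and> (\<forall>i. norm (partial i f y - partial i f x) < e')) (nhds x)"
  proof (intro eventually_conj eventually_nhds_in_open U eventually_all_finite)
    fix i
    have "continuous (at x) (partial i f)"
      using ct U continuous_on_eq_continuous_at by blast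
    then have "((partial i f) \<longlongrightarrow> partial i f x) (nhds x)"
      by (metis continuous_at tendsto_at_iff_tendsto_nhds)
    then show "eventually (\<lambda>y. norm (partial i f y - partial i f x) < e') (nhds x)"
      using e' by (auto dest: tendstoD simp: dist_norm)
  qed
  then obtain d where d: "d > 0" and
    dU: "\<And>y. dist y x < d \<Longrightarrow> y \<in> U \<and> (\<forall>i. norm (partial i f y - partial i f x) < e')"
    unfolding eventually_nhds_metric by blast
  \<comment> \<open>Induction over the set \<open>I\<close> of coordinates in which the increment
    may be nonzero.\<close>
  have key: "norm (f (x + h) - f x - (\<Sum>i\<in>I. (h $ i) *\<^sub>R partial i f x)) \<le> e' * (\<Sum>i\<in>I. \<bar>h $ i\<bar>)"
    if "finite I" "\<And>i. i \<notin> I \<Longrightarrow> h $ i = 0" "norm h < d" for I h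
    using that
  proof (induction I arbitrary: h rule: finite_induct)
    case empty
    then have "h = 0" by (simp add: vec_eq_iff)
    then show ?case by simp
  next
    case (insert j I)
    define h' where "h' = h - (h $ j) *\<^sub>R axis j 1"
    have h'_nth: "h' $ i = (if i = j then 0 else h $ i)" for i
      by (simp add: h'_def axis_def)
    \<comment> \<open>The segment along axis \<open>j\<close> lies componentwise below
      \<open>h\<close> in absolute value, so it stays in the ball of radius
      \<open>d\<close>.\<close>
    have le: "norm (h' + t *\<^sub>R axis j 1) \<le> norm h" if "\<bar>t\<bar> \<le> \<bar>h $ j\<bar>" for t
      using that by (intro norm_le_componentwise_cart) (auto simp: h'_nth axis_def)
    have "norm h' < d"
      using le[of 0] insert.prems by simp
    then have IH: "norm (f (x + h') - f x - (\<Sum>i\<in>I. (h' $ i) *\<^sub>R partial i f x)) \<le> e' * (\<Sum>i\<in>I. \<bar>h' $ i\<bar>)"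
      using insert.prems by (intro insert.IH) (auto simp: h'_nth)
    have eq: "x + h' + (h $ j) *\<^sub>R axis j 1 = x + h"
      by (simp add: h'_def)
    have "norm (f (x + h' + (h $ j) *\<^sub>R axis j 1) - f (x + h') - (h $ j) *\<^sub>R partial j f x) \<le> e' * \<bar>h $ j\<bar>"
    proof (rule axis_increment_bound)
      fix t assume "t \<in> closed_segment 0 (h $ j)"
      then have "dist (x + h' + t *\<^sub>R axis j 1) x < d"
        using le[OF closed_segment_0_abs_le] insert.prems by (force simp: dist_norm add.assoc)
      from dU[OF this]
      show "has_partial j f (x + h' + t *\<^sub>R axis j 1)"
        "norm (partial j f (x + h' + t *\<^sub>R axis j 1) - partial j f x) \<le> e'"
        using hp by (auto simp: less_imp_le)
    qed
    note inc = this[unfolded eq]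
    have "(\<Sum>i\<in>I. (h' $ i) *\<^sub>R partial i f x) = (\<Sum>i\<in>I. (h $ i) *\<^sub>R partial i f x)"
      "(\<Sum>i\<in>I. \<bar>h' $ i\<bar>) = (\<Sum>i\<in>I. \<bar>h $ i\<bar>)"
      using insert.hyps by (auto intro!: sum.cong simp: h'_nth)
    then show ?case
      using insert.hyps IH inc
        norm_triangle_ineq[of "f (x + h) - f (x + h') - (h $ j) *\<^sub>R partial j f x"
          "f (x + h') - f x - (\<Sum>i\<in>I. (h $ i) *\<^sub>R partial i f x)"]
      by (simp add: algebra_simps)
  qed
  show "\<exists>d>0. \<forall>y. norm (y - x) < d \<longrightarrow>
      norm (f y - f x - (\<Sum>i\<in>UNIV. ((y - x) $ i) *\<^sub>R partial i f x)) \<le> e * norm (y - x)"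
  proof (intro exI[of _ d] conjI d allI impI)
    fix y assume "norm (y - x) < d"
    then have "norm (f y - f x - (\<Sum>i\<in>UNIV. ((y - x) $ i) *\<^sub>R partial i f x))
        \<le> e' * (\<Sum>i\<in>UNIV. \<bar>(y - x) $ i\<bar>)"
      using key[of UNIV "y - x"] by simp
    also have "\<dots> \<le> e' * (\<Sum>i\<in>(UNIV::'n set). norm (y - x))"
      using e' by (intro mult_left_mono sum_mono component_le_norm_cart) auto
    also have "\<dots> = e * norm (y - x)"
      by (simp add: e'_def)
    finally show "norm (f y - f x - (\<Sum>i\<in>UNIV. ((y - x) $ i) *\<^sub>R partial i f x)) \<le> e * norm (y - x)" .
  qed
qed

section \<open>Symmetry of mixed partial derivatives\<close>

lemma has_partial_shift_diff:
  assumes "has_partial i f (y + v)" "has_partial i f y"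
  shows "has_partial i (\<lambda>z. f (z + v) - f z) y"
    and "partial i (\<lambda>z. f (z + v) - f z) y = partial i f (y + v) - partial i f y"
proof -
  have "((\<lambda>t. f (y + t *\<^sub>R axis i 1 + v) - f (y + t *\<^sub>R axis i 1)) has_vector_derivative
      (partial i f (y + v) - partial i f y)) (at 0)"
    using has_vector_derivative_diff[OF assms[unfolded has_partial_iff]]
    by (simp add: algebra_simps)
  then show "has_partial i (\<lambda>z. f (z + v) - f z) y"
    "partial i (\<lambda>z. f (z + v) - f z) y = partial i f (y + v) - partial i f y"
    by (auto simp: has_partial_def partial_def differentiableI_vector vector_derivative_at)
qed

text \<open>The second difference is the increment along axis \<open>i\<close> of \<open>F\<close>,
  the difference of \<open>f\<close> over a step along axis \<open>j\<close>. The partial derivative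
  of \<open>F\<close> is in turn an increment of \<open>partial i f\<close> along axis
  \<open>j\<close>, so the mean value inequality applies twice, each time contributing a factor
  \<open>s\<close>.\<close>

lemma second_difference_bound:
  fixes f :: "real^'n::finite \<Rightarrow> complex"
  assumes hp: "\<And>y. dist y x < d \<Longrightarrow> has_partial i f y \<and> has_partial j (partial i f) y"
    and bd: "\<And>y. dist y x < d \<Longrightarrow> norm (partial j (partial i f) y - partial j (partial i f) x) \<le> e"
    and s: "0 < s" "2 * s < d"
  shows "norm (f (x + s *\<^sub>R axis i 1 + s *\<^sub>R axis j 1) - f (x + s *\<^sub>R axis i 1) - f (x + s *\<^sub>R axis j 1) + f x
           - (s * s) *\<^sub>R partial j (partial i f) x) \<le> e * (s * s)"
proof -
  define F where "F z = f (z + s *\<^sub>R axis j 1) - f z" for z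
  have near: "dist (x + t *\<^sub>R axis i 1 + u *\<^sub>R axis j 1) x < d" if "\<bar>t\<bar> \<le> s" "\<bar>u\<bar> \<le> s" for t u
    using norm_triangle_ineq[of "t *\<^sub>R (axis i 1 :: real^'n)" "u *\<^sub>R axis j 1"] that s
    by (simp add: dist_norm add.assoc)
  have near1: "dist (x + t *\<^sub>R axis i 1) x < d" if "\<bar>t\<bar> \<le> s" for t
    using near[OF that, of 0] s by simp
  have "norm (F (x + s *\<^sub>R axis i 1) - F x - s *\<^sub>R (s *\<^sub>R partial j (partial i f) x)) \<le> (e * s) * \<bar>s\<bar>"
  proof (rule axis_increment_bound)
    fix t assume "t \<in> closed_segment 0 s"
    then have t: "\<bar>t\<bar> \<le> s"
      using closed_segment_0_abs_le s by fastforce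
    note F = has_partial_shift_diff[of i f "x + t *\<^sub>R axis i 1" "s *\<^sub>R axis j 1"]
    show "has_partial i F (x + t *\<^sub>R axis i 1)"
      unfolding F_def using t s hp near near1 by (intro F) auto
    have eq: "partial i F (x + t *\<^sub>R axis i 1) =
        partial i f (x + t *\<^sub>R axis i 1 + s *\<^sub>R axis j 1) - partial i f (x + t *\<^sub>R axis i 1)"
      unfolding F_def using t s hp near near1 by (intro F) auto
    have "norm (partial i f (x + t *\<^sub>R axis i 1 + s *\<^sub>R axis j 1) - partial i f (x + t *\<^sub>R axis i 1)
        - s *\<^sub>R partial j (partial i f) x) \<le> e * \<bar>s\<bar>"
    proof (rule axis_increment_bound)
      fix u assume "u \<in> closed_segment 0 s"
      then have "\<bar>u\<bar> \<le> s"
        using closed_segment_0_abs_le s by fastforce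
      then show "has_partial j (partial i f) (x + t *\<^sub>R axis i 1 + u *\<^sub>R axis j 1)"
        "norm (partial j (partial i f) (x + t *\<^sub>R axis i 1 + u *\<^sub>R axis j 1)
          - partial j (partial i f) x) \<le> e"
        using hp bd near t by auto
    qed
    then show "norm (partial i F (x + t *\<^sub>R axis i 1) - s *\<^sub>R partial j (partial i f) x) \<le> e * s"
      using eq s by simp
  qed
  then show ?thesis
    using s by (simp add: F_def algebra_simps)
qed

text \<open>The second difference is symmetric in \<open>i\<close> and \<open>j\<close>. Divided by
  \<open>s * s\<close> it is within \<open>e\<close> of both mixed derivatives, which therefore
  differ by at most \<open>2 * e\<close>.\<close>

lemma partial_commute:
  fixes f :: "real^'n::finite \<Rightarrow> complex"
  assumes U: "open U" "x \<in> U"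
    and hp: "\<And>y. y \<in> U \<Longrightarrow> has_partial i f y" "\<And>y. y \<in> U \<Longrightarrow> has_partial j f y"
      "\<And>y. y \<in> U \<Longrightarrow> has_partial j (partial i f) y" "\<And>y. y \<in> U \<Longrightarrow> has_partial i (partial j f) y"
    and ct: "continuous_on U (partial j (partial i f))" "continuous_on U (partial i (partial j f))"
  shows "partial j (partial i f) x = partial i (partial j f) x"
proof -
  let ?A = "partial j (partial i f)" and ?B = "partial i (partial j f)"
  have "norm (?A x - ?B x) \<le> 2 * e" if "e > 0" for e
  proof -
    have near: "eventually (\<lambda>y. norm (g y - g x) < e) (nhds x)"
      if "continuous_on U g" for g :: "real^'n \<Rightarrow> complex"
    proof -
      have "continuous (at x) g"
        using that U continuous_on_eq_continuous_at by blast
      then have "(g \<longlongrightarrow> g x) (nhds x)"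
        by (metis continuous_at tendsto_at_iff_tendsto_nhds)
      then show ?thesis
        using \<open>e > 0\<close> by (auto dest: tendstoD simp: dist_norm)
    qed
    have "eventually (\<lambda>y. y \<in> U \<and> norm (?A y - ?A x) < e \<and> norm (?B y - ?B x) < e) (nhds x)"
      by (intro eventually_conj eventually_nhds_in_open U near ct)
    then obtain d where d: "d > 0"
      "\<And>y. dist y x < d \<Longrightarrow> y \<in> U \<and> norm (?A y - ?A x) < e \<and> norm (?B y - ?B x) < e"
      unfolding eventually_nhds_metric by blast
    define s where "s = d / 3"
    have s: "0 < s" "2 * s < d"
      using d(1) by (auto simp: s_def)
    let ?X = "f (x + s *\<^sub>R axis i 1 + s *\<^sub>R axis j 1) - f (x + s *\<^sub>R axis i 1) - f (x + s *\<^sub>R axis j 1) + f x"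
    have 1: "norm (?X - (s * s) *\<^sub>R ?A x) \<le> e * (s * s)"
      by (rule second_difference_bound[OF _ _ s]) (use d hp in \<open>auto simp: less_imp_le\<close>)
    have "norm (f (x + s *\<^sub>R axis j 1 + s *\<^sub>R axis i 1) - f (x + s *\<^sub>R axis j 1) - f (x + s *\<^sub>R axis i 1) + f x
           - (s * s) *\<^sub>R ?B x) \<le> e * (s * s)"
      by (rule second_difference_bound[OF _ _ s]) (use d hp in \<open>auto simp: less_imp_le\<close>)
    then have 2: "norm (?X - (s * s) *\<^sub>R ?B x) \<le> e * (s * s)"
      by (simp add: algebra_simps)
    have "norm ((s * s) *\<^sub>R (?A x - ?B x)) \<le> 2 * e * (s * s)"
      using norm_triangle_ineq4[of "?X - (s * s) *\<^sub>R ?B x" "?X - (s * s) *\<^sub>R ?A x"] 1 2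
      by (simp add: scaleR_diff_right)
    then show ?thesis
      using s by (simp add: abs_mult mult.commute)
  qed
  \<comment> \<open>With \<open>e\<close> a quarter of the gap, the gap is at most half of
    itself.\<close>
  from this[of "norm (?A x - ?B x) / 4"] show ?thesis
    by (cases "?A x = ?B x") auto
qed

section \<open>Iterated partial derivatives and multi-indices\<close>

lemma Ck_imp_C0: "Ck k U f \<Longrightarrow> C0 U f"
  by (cases k) auto

lemma C0_imp_continuous_on: "C0 U f \<Longrightarrow> continuous_on U f"
  by (simp add: C0_def uniformly_continuous_imp_continuous)

lemma Ck_pd:
  assumes "Ck k U f" "length l \<le> k"
  shows "Ck (k - length l) U (pd l f)"
  using assms(2)
proof (induction l)
  case (Cons i l)
  then have "k - length l = Suc (k - length (i # l))"
    by simp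
  with Cons show ?case
    by simp
qed (use assms in simp)

lemma Ck_has_partial_pd:
  assumes "Ck k U f" "length l < k" "x \<in> U"
  shows "has_partial i (pd l f) x"
proof -
  obtain m where "k - length l = Suc m"
    using assms(2) by (metis Suc_diff_Suc)
  then show ?thesis
    using Ck_pd[OF assms(1), of l] assms by simp
qed

lemma Ck_continuous_pd:
  assumes "Ck k U f" "length l \<le> k"
  shows "continuous_on U (pd l f)"
  using Ck_pd[OF assms] by (intro C0_imp_continuous_on Ck_imp_C0)

lemma has_derivative_pd:
  fixes f :: "real^'n::finite \<Rightarrow> complex"
  assumes "Ck k U f" "open U" "length l < k" "x \<in> U"
  shows "(pd l f has_derivative (\<lambda>h. \<Sum>i\<in>UNIV. (h $ i) *\<^sub>R pd (i # l) f x)) (at x)"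
  using has_derivative_of_continuous_partials[OF assms(2,4), of "pd l f"]
    Ck_has_partial_pd[OF assms(1,3)] Ck_continuous_pd[OF assms(1), of "_ # l"] assms(3)
  by simp

lemma pd_swap:
  fixes f :: "real^'n::finite \<Rightarrow> complex"
  assumes "Ck k U f" "open U" "length l + 2 \<le> k" "x \<in> U"
  shows "pd (j # i # l) f x = pd (i # j # l) f x"
  using partial_commute[OF assms(2,4), of i "pd l f" j]
    Ck_has_partial_pd[OF assms(1), of l] Ck_has_partial_pd[OF assms(1), of "_ # l"]
    Ck_continuous_pd[OF assms(1), of "_ # _ # l"] assms(3)
  by simp

lemma pd_move_to_front:
  fixes f :: "real^'n::finite \<Rightarrow> complex"
  assumes "Ck k U f" "open U" "length (l @ i # l') \<le> k" "x \<in> U"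
  shows "pd (l @ i # l') f x = pd (i # l @ l') f x"
  using assms(3,4)
proof (induction l arbitrary: x)
  case (Cons j l)
  have "pd (j # l @ i # l') f x = pd [j] (pd (l @ i # l') f) x"
    by simp
  also have "\<dots> = pd [j] (pd (i # l @ l') f) x"
    using Cons by (intro pd_cong[OF assms(2)] Cons.IH) auto
  also have "\<dots> = pd (j # i # l @ l') f x"
    by simp
  also have "\<dots> = pd (i # j # l @ l') f x"
    using Cons.prems by (intro pd_swap[OF assms(1,2)]) auto
  finally show ?case by simp
qed simp

text \<open>\<open>D\<close> differentiates in the order fixed by \<open>mi_list\<close>, whereas
  the chain rule prepends indices in any order. The two orders are matched by moving the head of
  \<open>l\<close> to the front of \<open>l'\<close> and recursing.\<close>

lemma pd_permute:
  fixes f :: "real^'n::finite \<Rightarrow> complex"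
  assumes "Ck k U f" "open U" "mset l = mset l'" "length l \<le> k" "x \<in> U"
  shows "pd l f x = pd l' f x"
  using assms(3,4,5)
proof (induction l arbitrary: l' x)
  case (Cons i l)
  then have "i \<in> set l'"
    by (metis list.set_intros(1) set_mset_mset)
  then obtain a b where ab: "l' = a @ i # b"
    by (meson split_list)
  have m: "mset l = mset (a @ b)"
    using Cons.prems(1) ab by simp
  have "pd (i # l) f x = pd [i] (pd l f) x"
    by simp
  also have "\<dots> = pd [i] (pd (a @ b) f) x"
    using Cons m by (intro pd_cong[OF assms(2)] Cons.IH) auto
  also have "\<dots> = pd (i # a @ b) f x"
    by simp
  also have "\<dots> = pd l' f x"
    unfolding ab using Cons.prems mset_eq_length[OF m]
    by (intro pd_move_to_front[OF assms(1,2), symmetric]) auto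
  finally show ?case .
qed simp

lemma count_mset_mi_list: "count (mset (mi_list \<beta>)) i = \<beta> i"
proof -
  have "count (mset (concat (map (\<lambda>i. replicate (\<beta> i) i) xs))) i = (if i \<in> set xs then \<beta> i else 0)"
    if "distinct xs" for xs
    using that by (induction xs) auto
  from this[of "sorted_list_of_set UNIV"] show ?thesis
    by (simp add: mi_list_def)
qed

lemma length_mi_list: "length (mi_list \<beta>) = mi_order \<beta>"
proof -
  have "length (mi_list \<beta>) = (\<Sum>i\<leftarrow>sorted_list_of_set UNIV. \<beta> i)"
    by (simp add: mi_list_def length_concat o_def)
  then show ?thesis
    by (simp add: mi_order_def sum_list_distinct_conv_sum_set)
qed

text \<open>Turns the bounds on \<open>D\<close> contained in the norms into bounds for arbitrary
  index lists; the multi-index of a list counts its entries.\<close>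

lemma pd_eq_D:
  fixes f :: "real^'n::{finite,linorder} \<Rightarrow> complex"
  assumes "Ck k U f" "open U" "length l \<le> k" "x \<in> U"
  shows "pd l f x = D (count (mset l)) f x" and "mi_order (count (mset l)) = length l"
proof -
  have m: "mset l = mset (mi_list (count (mset l)))"
    by (simp add: multiset_eq_iff count_mset_mi_list)
  show "pd l f x = D (count (mset l)) f x"
    unfolding D_def by (rule pd_permute[OF assms(1,2) m assms(3,4)])
  show "mi_order (count (mset l)) = length l"
    using mset_eq_length[OF m] length_mi_list by metis
qed

lemma finite_B: "finite (B k :: ('n::finite \<Rightarrow> nat) set)"
proof (rule finite_subset)
  show "B k \<subseteq> (PiE UNIV (\<lambda>_. {..k}) :: ('n \<Rightarrow> nat) set)"
  proof
    fix \<beta> :: "'n \<Rightarrow> nat" assume "\<beta> \<in> B k"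
    then have "\<beta> i \<le> k" for i
      using member_le_sum[of i UNIV \<beta>] by (simp add: B_def mi_order_def)
    then show "\<beta> \<in> PiE UNIV (\<lambda>_. {..k})"
      by (auto simp: PiE_def)
  qed
qed (auto intro: finite_PiE)

section \<open>Derivatives of the DFS function\<close>

text \<open>Phases let cosines stand for sines, and zero frequencies cover functions of one
  variable. The bounds by \<open>1\<close> are chosen so that the set is closed under partial
  differentiation.\<close>

definition trig_atoms :: "(real^2 \<Rightarrow> real) set" where
  "trig_atoms = {\<lambda>p. r * cos (a * p $ 1 + u) * cos (b * p $ 2 + v) | r a u b v.
     \<bar>r\<bar> \<le> 1 \<and> \<bar>a\<bar> \<le> 1 \<and> \<bar>b\<bar> \<le> 1}"

lemma trig_atomsI:
  "\<bar>r\<bar> \<le> 1 \<Longrightarrow> \<bar>a\<bar> \<le> 1 \<Longrightarrow> \<bar>b\<bar> \<le> 1 \<Longrightarrow>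
    (\<lambda>p. r * cos (a * p $ 1 + u) * cos (b * p $ 2 + v)) \<in> trig_atoms"
  unfolding trig_atoms_def by blast

lemma trig_atom_bound:
  assumes "c \<in> trig_atoms"
  shows "\<bar>c p\<bar> \<le> 1"
  using assms by (auto simp: trig_atoms_def abs_mult intro!: mult_le_one)

text \<open>Differentiation shifts a phase by \<open>pi / 2\<close> and multiplies the amplitude by
  a frequency, which keeps its absolute value at most \<open>1\<close>.\<close>

lemma trig_atom_derivative:
  assumes "c \<in> trig_atoms"
  shows "\<exists>c'. (\<forall>i. c' i \<in> trig_atoms) \<and> (\<forall>p. (c has_derivative (\<lambda>h. \<Sum>i\<in>UNIV. h $ i * c' i p)) (at p))"
proof -
  obtain r a u b v where c: "c = (\<lambda>p. r * cos (a * p $ 1 + u) * cos (b * p $ 2 + v))"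
    and le: "\<bar>r\<bar> \<le> 1" "\<bar>a\<bar> \<le> 1" "\<bar>b\<bar> \<le> 1"
    using assms by (auto simp: trig_atoms_def)
  define c' :: "2 \<Rightarrow> real^2 \<Rightarrow> real"
    where "c' i = (if i = 1 then (\<lambda>p. (r * a) * cos (a * p $ 1 + (u + pi / 2)) * cos (b * p $ 2 + v))
      else (\<lambda>p. (r * b) * cos (a * p $ 1 + u) * cos (b * p $ 2 + (v + pi / 2))))" for i
  have "c' i \<in> trig_atoms" for i
    unfolding c'_def using le by (auto intro!: trig_atomsI simp: abs_mult mult_le_one)
  moreover have "(c has_derivative (\<lambda>h. \<Sum>i\<in>UNIV. h $ i * c' i p)) (at p)" for p
  proof -
    have "cos (z + pi / 2) = - sin z" for z :: real
      by (simp add: cos_add)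
    then have shift: "cos (x + (y + pi / 2)) = - sin (x + y)" for x y :: real
      by (metis add.assoc)
    have nth: "((\<lambda>p. p $ i) has_derivative (\<lambda>h. h $ i)) (at p)" for i :: 2
      by (rule bounded_linear_imp_has_derivative) (rule bounded_linear_vec_nth)
    show ?thesis
      unfolding c
      by (rule has_derivative_eq_rhs, (rule derivative_intros nth)+)
        (simp add: fun_eq_iff sum_2 c'_def shift; simp add: algebra_simps)
  qed
  ultimately show ?thesis by blast
qed

text \<open>The factor \<open>2\<close> counts the coordinates of the plane: each component of
  \<open>h\<close> is at most \<open>norm h\<close>.\<close>

lemma lipschitz_of_partial_bound:
  fixes f :: "real^2 \<Rightarrow> 'b::real_normed_vector"
  assumes der: "\<And>p. (f has_derivative (\<lambda>h. \<Sum>i\<in>UNIV. h $ i *\<^sub>R f' i p)) (at p)"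
    and bd: "\<And>i p. norm (f' i p) \<le> L"
  shows "norm (f p - f q) \<le> 2 * L * norm (p - q)"
proof (rule differentiable_bound[of UNIV])
  fix x
  show "(f has_derivative (\<lambda>h. \<Sum>i\<in>UNIV. h $ i *\<^sub>R f' i x)) (at x within UNIV)"
    using der by simp
  show "onorm (\<lambda>h. \<Sum>i\<in>UNIV. h $ i *\<^sub>R f' i x) \<le> 2 * L"
  proof (rule onorm_le)
    fix h :: "real^2"
    have "norm (\<Sum>i\<in>UNIV. h $ i *\<^sub>R f' i x) \<le> (\<Sum>i\<in>(UNIV::2 set). norm h * L)"
      by (rule sum_norm_le) (auto intro!: mult_mono bd component_le_norm_cart)
    then show "norm (\<Sum>i\<in>UNIV. h $ i *\<^sub>R f' i x) \<le> 2 * L * norm h"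
      by (simp add: mult.commute mult.left_commute)
  qed
qed auto

lemma trig_atom_lipschitz:
  assumes "c \<in> trig_atoms"
  shows "\<bar>c p - c q\<bar> \<le> 2 * norm (p - q)"
proof -
  obtain c' where "\<And>i. c' i \<in> trig_atoms"
    "\<And>p. (c has_derivative (\<lambda>h. \<Sum>i\<in>UNIV. h $ i * c' i p)) (at p)"
    using trig_atom_derivative[OF assms] by blast
  then show ?thesis
    using lipschitz_of_partial_bound[of c c' 1 p q] trig_atom_bound by auto
qed

text \<open>For \<open>d \<le> 1\<close> the power \<open>d powr \<alpha>\<close> is at least
  \<open>d\<close>, otherwise at least \<open>1\<close>. Hence a Lipschitz bound and a bound on the
  oscillation yield a Hoelder bound with the same constant, on all of the unbounded plane.\<close>

lemma le_powr_of_le_min: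
  fixes x c d \<alpha> :: real
  assumes "0 \<le> d" "0 < \<alpha>" "\<alpha> < 1" "0 \<le> c" "x \<le> c * d" "x \<le> c"
  shows "x \<le> c * d powr \<alpha>"
proof (cases "d \<le> 1")
  case True
  then have "d powr 1 \<le> d powr \<alpha>"
    using assms by (intro powr_mono') auto
  then show ?thesis
    using assms mult_left_mono[of d "d powr \<alpha>" c] by (simp add: powr_one)
next
  case False
  then have "1 \<le> d powr \<alpha>"
    using assms by (intro ge_one_powr_ge_zero) auto
  then show ?thesis
    using assms mult_left_mono[of 1 "d powr \<alpha>" c] by simp
qed

lemma trig_atom_holder:
  assumes "c \<in> trig_atoms" "0 < \<alpha>" "\<alpha> < 1"
  shows "\<bar>c p - c q\<bar> \<le> 2 * norm (p - q) powr \<alpha>"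
  using trig_atom_lipschitz[OF assms(1), of p q] trig_atom_bound[OF assms(1), of p]
    trig_atom_bound[OF assms(1), of q] assms
  by (intro le_powr_of_le_min) auto

definition atom_prod :: "(real^2 \<Rightarrow> real) list \<Rightarrow> real^2 \<Rightarrow> real" where
  "atom_prod cs p = (\<Prod>c\<leftarrow>cs. c p)"

lemma atom_prod_simps [simp]:
  "atom_prod [] p = 1" "atom_prod (c # cs) p = c p * atom_prod cs p"
  by (auto simp: atom_prod_def)

lemma atom_prod_bound:
  assumes "set cs \<subseteq> trig_atoms"
  shows "\<bar>atom_prod cs p\<bar> \<le> 1"
  using assms by (induction cs) (auto simp: abs_mult intro!: mult_le_one trig_atom_bound)

text \<open>The factors are exchanged one at a time. All others are bounded by \<open>1\<close>, so
  each exchange costs the Hoelder constant \<open>2\<close> of a single atom.\<close>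

lemma atom_prod_holder:
  assumes "set cs \<subseteq> trig_atoms" "0 < \<alpha>" "\<alpha> < 1"
  shows "\<bar>atom_prod cs p - atom_prod cs q\<bar> \<le> 2 * real (length cs) * norm (p - q) powr \<alpha>"
  using assms(1)
proof (induction cs)
  case (Cons c cs)
  have "c p * atom_prod cs p - c q * atom_prod cs q
      = (c p - c q) * atom_prod cs p + c q * (atom_prod cs p - atom_prod cs q)"
    by (simp add: algebra_simps)
  then have "\<bar>c p * atom_prod cs p - c q * atom_prod cs q\<bar>
      \<le> \<bar>c p - c q\<bar> * \<bar>atom_prod cs p\<bar> + \<bar>c q\<bar> * \<bar>atom_prod cs p - atom_prod cs q\<bar>"
    by (metis abs_mult abs_triangle_ineq)
  also have "\<dots> \<le> \<bar>c p - c q\<bar> * 1 + 1 * \<bar>atom_prod cs p - atom_prod cs q\<bar>"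
    using Cons.prems by (intro add_mono mult_mono atom_prod_bound trig_atom_bound) auto
  also have "\<dots> \<le> 2 * norm (p - q) powr \<alpha> + 2 * real (length cs) * norm (p - q) powr \<alpha>"
    using Cons trig_atom_holder[OF _ assms(2,3), of c p q] by auto
  finally show ?case
    by (simp add: algebra_simps)
qed simp

text \<open>Product rule: one summand per factor, in which that factor is replaced by its
  derivative, again an atom. The number of factors is therefore preserved.\<close>

lemma atom_prod_derivative:
  assumes "set cs \<subseteq> trig_atoms"
  shows "\<exists>Q. (\<forall>i. length (Q i) = length cs \<and> (\<forall>qs\<in>set (Q i). length qs = length cs \<and> set qs \<subseteq> trig_atoms)) \<and>
    (\<forall>p. (atom_prod cs has_derivative (\<lambda>h. \<Sum>i\<in>UNIV. h $ i * (\<Sum>qs\<leftarrow>Q i. atom_prod qs p))) (at p))"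
  using assms
proof (induction cs)
  case Nil
  show ?case
    by (rule exI[of _ "\<lambda>_. []"]) (simp add: atom_prod_def)
next
  case (Cons c cs)
  then obtain Q where Q: "\<And>i. length (Q i) = length cs"
      "\<And>i qs. qs \<in> set (Q i) \<Longrightarrow> length qs = length cs \<and> set qs \<subseteq> trig_atoms"
    and dQ: "\<And>p. (atom_prod cs has_derivative (\<lambda>h. \<Sum>i\<in>UNIV. h $ i * (\<Sum>qs\<leftarrow>Q i. atom_prod qs p))) (at p)"
    by fastforce
  obtain c' where c': "\<And>i. c' i \<in> trig_atoms"
    and dc: "\<And>p. (c has_derivative (\<lambda>h. \<Sum>i\<in>UNIV. h $ i * c' i p)) (at p)"
    using trig_atom_derivative[of c] Cons.prems by auto
  define R where "R i = (c' i # cs) # map (Cons c) (Q i)" for i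
  have "(atom_prod (c # cs) has_derivative (\<lambda>h. \<Sum>i\<in>UNIV. h $ i * (\<Sum>qs\<leftarrow>R i. atom_prod qs p))) (at p)" for p
  proof -
    have eq: "(\<Sum>qs\<leftarrow>R i. atom_prod qs p) = c' i p * atom_prod cs p + c p * (\<Sum>qs\<leftarrow>Q i. atom_prod qs p)" for i
      by (simp add: R_def o_def sum_list_const_mult)
    have "((\<lambda>p. c p * atom_prod cs p) has_derivative
        (\<lambda>h. c p * (\<Sum>i\<in>UNIV. h $ i * (\<Sum>qs\<leftarrow>Q i. atom_prod qs p)) + (\<Sum>i\<in>UNIV. h $ i * c' i p) * atom_prod cs p)) (at p)"
      by (rule has_derivative_mult[OF dc dQ])
    then show ?thesis
      unfolding atom_prod_simps(2)[abs_def]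
      by (simp add: eq algebra_simps sum.distrib sum_distrib_left sum_distrib_right)
  qed
  moreover have "length (R i) = length (c # cs) \<and> (\<forall>qs\<in>set (R i). length qs = length (c # cs) \<and> set qs \<subseteq> trig_atoms)" for i
    using Q(2)[of _ i] Q(1)[of i] c' Cons.prems by (auto simp: R_def)
  ultimately show ?case by blast
qed

section \<open>The DFS parametrisation of the sphere\<close>

abbreviation dfs_point :: "real^2 \<Rightarrow> real^3" where
  "dfs_point p \<equiv> dfs_phi (p $ 1) (p $ 2)"

lemma dfs_point_in_S2: "dfs_point p \<in> S2"
proof -
  have "(cos a * sin b)\<^sup>2 + (sin a * sin b)\<^sup>2 + (cos b)\<^sup>2 = ((sin a)\<^sup>2 + (cos a)\<^sup>2) * (sin b)\<^sup>2 + (cos b)\<^sup>2"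
    for a b :: real by (simp only: power_mult_distrib algebra_simps)
  then have "(cos a * sin b)\<^sup>2 + (sin a * sin b)\<^sup>2 + (cos b)\<^sup>2 = 1" for a b :: real
    by simp
  then show ?thesis
    by (simp add: S2_def dfs_phi_def norm_vec_def L2_set_def sum_3)
qed

lemma dfs_point_nth_in_trig_atoms: "(\<lambda>p. dfs_point p $ l) \<in> trig_atoms"
proof -
  \<comment> \<open>Sines become cosines with phase \<open>- pi / 2\<close>; the third coordinate
    has frequency \<open>0\<close> in the first variable.\<close>
  have *: "cos (x - pi / 2) = sin x" for x :: real
    by (simp add: cos_diff)
  consider "l = 1" | "l = 2" | "l = 3"
    using exhaust_3 by blast
  then show ?thesis
    using trig_atomsI[of 1 1 1 0 "- pi / 2"] trig_atomsI[of 1 1 1 "- pi / 2" "- pi / 2"]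
      trig_atomsI[of 1 0 1 0 0]
    by cases (simp_all add: dfs_phi_def *)
qed

lemma dfs_point_derivative:
  "\<exists>e. (\<forall>l i. e l i \<in> trig_atoms) \<and>
    (\<forall>p. (dfs_point has_derivative (\<lambda>h. \<chi> l. \<Sum>i\<in>UNIV. h $ i * e l i p)) (at p))"
proof -
  have "\<forall>l. \<exists>e. (\<forall>i. e i \<in> trig_atoms) \<and>
    (\<forall>p. ((\<lambda>p. dfs_point p $ l) has_derivative (\<lambda>h. \<Sum>i\<in>UNIV. h $ i * e i p)) (at p))"
    using trig_atom_derivative[OF dfs_point_nth_in_trig_atoms] by blast
  from choice[OF this] obtain e where e: "\<And>l i. e l i \<in> trig_atoms"
    "\<And>l p. ((\<lambda>p. dfs_point p $ l) has_derivative (\<lambda>h. \<Sum>i\<in>UNIV. h $ i * e l i p)) (at p)"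
    by blast
  have "(dfs_point has_derivative (\<lambda>h. \<chi> l. \<Sum>i\<in>UNIV. h $ i * e l i p)) (at p)" for p
    using e(2) by (subst has_derivative_componentwise_within) (auto simp: Basis_vec_def inner_axis)
  with e(1) show ?thesis by blast
qed

text \<open>Three coordinates, each an atom with Lipschitz constant \<open>2\<close>.\<close>

lemma dfs_point_lipschitz: "norm (dfs_point p - dfs_point q) \<le> 6 * norm (p - q)"
proof -
  have "norm (dfs_point p - dfs_point q) \<le> (\<Sum>l\<in>UNIV. \<bar>(dfs_point p - dfs_point q) $ l\<bar>)"
    by (rule norm_le_l1_cart)
  also have "\<dots> \<le> (\<Sum>l\<in>(UNIV :: 3 set). 2 * norm (p - q))"
    using trig_atom_lipschitz[OF dfs_point_nth_in_trig_atoms, of p _ q] by (intro sum_mono) simp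
  finally show ?thesis by simp
qed

section \<open>A family of sums closed under differentiation\<close>

definition dfs_term :: "(real^3 \<Rightarrow> complex) \<Rightarrow> 3 list \<times> (real^2 \<Rightarrow> real) list \<Rightarrow> real^2 \<Rightarrow> complex" where
  "dfs_term g t p = atom_prod (snd t) p *\<^sub>R pd (fst t) g (dfs_point p)"

definition dfs_sum :: "(real^3 \<Rightarrow> complex) \<Rightarrow> (3 list \<times> (real^2 \<Rightarrow> real) list) list \<Rightarrow> real^2 \<Rightarrow> complex" where
  "dfs_sum g ts p = (\<Sum>t\<leftarrow>ts. dfs_term g t p)"

text \<open>The first bound limits the order of differentiation of \<open>g\<close>. The second
  limits both the number of product rule summands in the next derivative and the Hoelder constant of
  the product.\<close>

definition admissible :: "nat \<Rightarrow> (3 list \<times> (real^2 \<Rightarrow> real) list) list \<Rightarrow> bool" where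
  "admissible m ts \<longleftrightarrow>
    (\<forall>t\<in>set ts. length (fst t) \<le> m \<and> length (snd t) \<le> m \<and> set (snd t) \<subseteq> trig_atoms)"

text \<open>Chain rule: the inner map takes values in the sphere, hence in the open set
  \<open>U\<close>, and order below \<open>k\<close> makes \<open>pd \<gamma> g\<close> totally
  differentiable there.\<close>

lemma has_derivative_pd_dfs_point:
  assumes "Ck k U g" "open U" "S2 \<subseteq> U" "length \<gamma> < k"
    and "(dfs_point has_derivative (\<lambda>h. \<chi> l. \<Sum>i\<in>UNIV. h $ i * e l i p)) (at p)"
  shows "((\<lambda>p. pd \<gamma> g (dfs_point p)) has_derivative
    (\<lambda>h. \<Sum>i\<in>UNIV. h $ i *\<^sub>R (\<Sum>l\<in>UNIV. e l i p *\<^sub>R pd (l # \<gamma>) g (dfs_point p)))) (at p)"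
  using has_derivative_compose[OF assms(5) has_derivative_pd[OF assms(1,2,4)]]
    assms(3) dfs_point_in_S2[of p]
  by (auto simp: sum_2 sum_3 algebra_simps scaleR_add_right scaleR_add_left)

text \<open>The chain rule contributes three summands and the product rule one for each of the
  at most \<open>m\<close> factors; this is the source of the factorial growth.\<close>

lemma dfs_term_derivative:
  assumes "Ck k U g" "open U" "S2 \<subseteq> U" "m < k"
    and t: "length (fst t) \<le> m" "length (snd t) \<le> m" "set (snd t) \<subseteq> trig_atoms"
  shows "\<exists>T. (\<forall>i. admissible (Suc m) (T i) \<and> length (T i) \<le> m + 3) \<and>
    (\<forall>p. (dfs_term g t has_derivative (\<lambda>h. \<Sum>i\<in>UNIV. h $ i *\<^sub>R dfs_sum g (T i) p)) (at p))"
proof -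
  obtain \<gamma> cs where tt: "t = (\<gamma>, cs)"
    by (cases t)
  obtain e where e: "\<And>l i. e l i \<in> trig_atoms"
    and de: "\<And>p. (dfs_point has_derivative (\<lambda>h. \<chi> l. \<Sum>i\<in>UNIV. h $ i * e l i p)) (at p)"
    using dfs_point_derivative by blast
  have cs: "set cs \<subseteq> trig_atoms"
    using t tt by simp
  obtain Q where Q: "\<And>i. length (Q i) = length cs"
      "\<And>i qs. qs \<in> set (Q i) \<Longrightarrow> length qs = length cs \<and> set qs \<subseteq> trig_atoms"
    and dQ: "\<And>p. (atom_prod cs has_derivative (\<lambda>h. \<Sum>i\<in>UNIV. h $ i * (\<Sum>qs\<leftarrow>Q i. atom_prod qs p))) (at p)"
    using atom_prod_derivative[OF cs] by blast
  define T where "T i = map (\<lambda>l. (l # \<gamma>, e l i # cs)) [1, 2, 3] @ map (\<lambda>qs. (\<gamma>, qs)) (Q i)" for i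
  have "admissible (Suc m) (T i) \<and> length (T i) \<le> m + 3" for i
    using t Q(2)[of _ i] Q(1)[of i] e by (auto simp: T_def admissible_def tt)
  moreover have "(dfs_term g t has_derivative (\<lambda>h. \<Sum>i\<in>UNIV. h $ i *\<^sub>R dfs_sum g (T i) p)) (at p)" for p
  proof -
    have pull: "(\<Sum>qs\<leftarrow>qss. atom_prod qs p *\<^sub>R z) = (\<Sum>qs\<leftarrow>qss. atom_prod qs p) *\<^sub>R z" for qss and z :: complex
      by (induction qss) (auto simp: scaleR_left_distrib)
    have sum: "dfs_sum g (T i) p = (\<Sum>l\<in>UNIV. (e l i p * atom_prod cs p) *\<^sub>R pd (l # \<gamma>) g (dfs_point p))
        + (\<Sum>qs\<leftarrow>Q i. atom_prod qs p) *\<^sub>R pd \<gamma> g (dfs_point p)" for i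
      by (simp add: dfs_sum_def T_def dfs_term_def o_def sum_3 pull)
    have "((\<lambda>p. pd \<gamma> g (dfs_point p)) has_derivative
        (\<lambda>h. \<Sum>i\<in>UNIV. h $ i *\<^sub>R (\<Sum>l\<in>UNIV. e l i p *\<^sub>R pd (l # \<gamma>) g (dfs_point p)))) (at p)"
      using t tt assms(4) by (intro has_derivative_pd_dfs_point[OF assms(1-3) _ de]) auto
    from has_derivative_scaleR[OF dQ this]
    show ?thesis
      unfolding dfs_term_def[abs_def] tt sum
      by (simp add: sum_2 sum_3 algebra_simps scaleR_add_right scaleR_add_left)
  qed
  ultimately show ?thesis by blast
qed

lemma dfs_sum_derivative:
  assumes "Ck k U g" "open U" "S2 \<subseteq> U" "m < k" "admissible m ts"
  shows "\<exists>T. (\<forall>i. admissible (Suc m) (T i) \<and> length (T i) \<le> (m + 3) * length ts) \<and>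
    (\<forall>p. (dfs_sum g ts has_derivative (\<lambda>h. \<Sum>i\<in>UNIV. h $ i *\<^sub>R dfs_sum g (T i) p)) (at p))"
  using assms(5)
proof (induction ts)
  case Nil
  show ?case
    by (rule exI[of _ "\<lambda>_. []"]) (simp add: dfs_sum_def[abs_def] admissible_def)
next
  case (Cons t ts)
  have t: "length (fst t) \<le> m" "length (snd t) \<le> m" "set (snd t) \<subseteq> trig_atoms"
    and ts: "admissible m ts"
    using Cons.prems by (auto simp: admissible_def)
  obtain T1 where T1: "\<And>i. admissible (Suc m) (T1 i) \<and> length (T1 i) \<le> m + 3"
    "\<And>p. (dfs_term g t has_derivative (\<lambda>h. \<Sum>i\<in>UNIV. h $ i *\<^sub>R dfs_sum g (T1 i) p)) (at p)"
    using dfs_term_derivative[OF assms(1-4) t] by blast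
  obtain T2 where T2: "\<And>i. admissible (Suc m) (T2 i) \<and> length (T2 i) \<le> (m + 3) * length ts"
    "\<And>p. (dfs_sum g ts has_derivative (\<lambda>h. \<Sum>i\<in>UNIV. h $ i *\<^sub>R dfs_sum g (T2 i) p)) (at p)"
    using Cons.IH[OF ts] by blast
  have "admissible (Suc m) (T1 i @ T2 i) \<and> length (T1 i @ T2 i) \<le> (m + 3) * length (t # ts)" for i
    using T1(1)[of i] T2(1)[of i] by (auto simp: admissible_def)
  moreover have "(dfs_sum g (t # ts) has_derivative
      (\<lambda>h. \<Sum>i\<in>UNIV. h $ i *\<^sub>R dfs_sum g (T1 i @ T2 i) p)) (at p)" for p
    using has_derivative_add[OF T1(2) T2(2), of p]
    by (simp add: dfs_sum_def[abs_def] scaleR_add_right sum.distrib)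
  ultimately show ?case
    by (intro exI[of _ "\<lambda>i. T1 i @ T2 i"]) blast
qed

lemma dfs_sum_partial:
  assumes "Ck k U g" "open U" "S2 \<subseteq> U" "m < k" "admissible m ts"
  shows "has_partial i (dfs_sum g ts) p"
    and "\<exists>ts'. admissible (Suc m) ts' \<and> length ts' \<le> (m + 3) * length ts \<and>
      partial i (dfs_sum g ts) = dfs_sum g ts'"
proof -
  obtain T where T: "\<And>i. admissible (Suc m) (T i) \<and> length (T i) \<le> (m + 3) * length ts"
    "\<And>p. (dfs_sum g ts has_derivative (\<lambda>h. \<Sum>i\<in>UNIV. h $ i *\<^sub>R dfs_sum g (T i) p)) (at p)"
    using dfs_sum_derivative[OF assms] by blast
  show "has_partial i (dfs_sum g ts) p"
    by (rule has_partialI[OF T(2)])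
  \<comment> \<open>Evaluating the total derivative at \<open>axis i 1\<close> leaves only the
    summand with index \<open>i\<close>.\<close>
  have "partial i (dfs_sum g ts) p = dfs_sum g (T i) p" for p
    by (subst has_partialI(2)[OF T(2)]) (simp add: axis_def if_distrib[of "\<lambda>x. x *\<^sub>R _"] cong: if_cong)
  then show "\<exists>ts'. admissible (Suc m) ts' \<and> length ts' \<le> (m + 3) * length ts \<and>
      partial i (dfs_sum g ts) = dfs_sum g ts'"
    using T(1) by (intro exI[of _ "T i"]) auto
qed

text \<open>Passing from order \<open>m\<close> to \<open>m + 1\<close> multiplies the number of
  terms by at most \<open>m + 3\<close>. The factor \<open>2\<close> on the left keeps the resulting
  bound \<open>fact (m + 2) / 2\<close> within the natural numbers.\<close>

lemma pd_dfs_eq_dfs_sum: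
  assumes "Ck k U g" "open U" "S2 \<subseteq> U" "length l \<le> k"
  shows "\<exists>ts. admissible (length l) ts \<and> 2 * length ts \<le> fact (length l + 2) \<and> pd l (dfs g) = dfs_sum g ts"
  using assms(4)
proof (induction l)
  case Nil
  \<comment> \<open>The single term with both lists empty is \<open>dfs g\<close> itself, and
    \<open>2 * 1 = fact 2\<close>.\<close>
  show ?case
    by (rule exI[of _ "[([], [])]"])
      (auto simp: admissible_def dfs_sum_def[abs_def] dfs_term_def dfs_def[abs_def] numeral_2_eq_2)
next
  case (Cons i l)
  then obtain ts where ts: "admissible (length l) ts" "2 * length ts \<le> fact (length l + 2)"
    "pd l (dfs g) = dfs_sum g ts"
    by auto
  obtain ts' where ts': "admissible (Suc (length l)) ts'" "length ts' \<le> (length l + 3) * length ts"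
    "partial i (dfs_sum g ts) = dfs_sum g ts'"
    using dfs_sum_partial(2)[OF assms(1-3) _ ts(1), of i] Cons.prems by auto
  have "2 * length ts' \<le> (length l + 3) * (2 * length ts)"
    using ts'(2) by simp
  also have "\<dots> \<le> (length l + 3) * fact (length l + 2)"
    using ts(2) by (rule mult_le_mono2)
  also have "\<dots> = fact (length (i # l) + 2)"
    by (simp add: numeral_eq_Suc algebra_simps)
  finally show ?case
    using ts ts' by auto
qed

section \<open>The norm estimates\<close>

lemma sum_list_norm_le:
  fixes F :: "'a \<Rightarrow> 'b::real_normed_vector"
  assumes "\<And>t. t \<in> set ts \<Longrightarrow> norm (F t) \<le> c"
  shows "norm (\<Sum>t\<leftarrow>ts. F t) \<le> real (length ts) * c"
  using assms
proof (induction ts)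
  case (Cons t ts)
  then show ?case
    using norm_triangle_ineq[of "F t" "\<Sum>t\<leftarrow>ts. F t"] by (fastforce simp: algebra_simps)
qed simp

text \<open>Collects what the estimates use of an extension: bounds at points of the sphere only,
  for arbitrary index lists, with one constant \<open>N\<close> both for the suprema and for the
  Hoelder quotients of top order.\<close>

locale bounded_extension =
  fixes k :: nat and \<alpha> :: real and U :: "(real^3) set" and g :: "real^3 \<Rightarrow> complex" and N :: real
  assumes alpha: "0 < \<alpha>" "\<alpha> < 1"
    and U: "open U" "S2 \<subseteq> U"
    and g: "Ck k U g"
    and pd_bound: "\<And>\<gamma> \<xi>. length \<gamma> \<le> k \<Longrightarrow> \<xi> \<in> S2 \<Longrightarrow> norm (pd \<gamma> g \<xi>) \<le> N"
    and pd_holder: "\<And>\<gamma> \<xi> \<eta>. length \<gamma> = k \<Longrightarrow> \<xi> \<in> S2 \<Longrightarrow> \<eta> \<in> S2 \<Longrightarrow>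
      norm (pd \<gamma> g \<xi> - pd \<gamma> g \<eta>) \<le> N * norm (\<xi> - \<eta>) powr \<alpha>"
begin

lemma N_nonneg: "0 \<le> N"
  using order_trans[OF norm_ge_zero pd_bound[of "[]", OF _ dfs_point_in_S2]] by simp

text \<open>At top order, the Hoelder bound is composed with the Lipschitz map
  \<open>dfs_point\<close>, using \<open>6 powr \<alpha> \<le> 6\<close>. Below top order, the mean
  value inequality is applied to the composition on the plane, which is convex, since segments
  between points of the sphere may leave \<open>U\<close>. The chain rule bounds its partial
  derivatives by \<open>3 * N\<close>, and the oscillation is at most \<open>2 * N\<close>.\<close>

lemma pd_dfs_point_holder:
  assumes "length \<gamma> \<le> k"
  shows "norm (pd \<gamma> g (dfs_point p) - pd \<gamma> g (dfs_point q)) \<le> 6 * N * norm (p - q) powr \<alpha>"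
proof (cases "length \<gamma> = k")
  case True
  have "norm (dfs_point p - dfs_point q) powr \<alpha> \<le> (6 * norm (p - q)) powr \<alpha>"
    using alpha by (intro powr_mono2 dfs_point_lipschitz) auto
  also have "\<dots> = 6 powr \<alpha> * norm (p - q) powr \<alpha>"
    by (simp add: powr_mult)
  also have "\<dots> \<le> 6 * norm (p - q) powr \<alpha>"
    using alpha powr_mono[of \<alpha> 1 6] by (intro mult_right_mono) auto
  finally have "N * norm (dfs_point p - dfs_point q) powr \<alpha> \<le> N * (6 * norm (p - q) powr \<alpha>)"
    by (intro mult_left_mono N_nonneg)
  then show ?thesis
    using pd_holder[OF True dfs_point_in_S2 dfs_point_in_S2, of p q] by simp
next
  case False
  then have lt: "length \<gamma> < k" using assms by simp
  obtain e where e: "\<And>l i. e l i \<in> trig_atoms"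
    and de: "\<And>p. (dfs_point has_derivative (\<lambda>h. \<chi> l. \<Sum>i\<in>UNIV. h $ i * e l i p)) (at p)"
    using dfs_point_derivative by blast
  have "norm (pd \<gamma> g (dfs_point p) - pd \<gamma> g (dfs_point q)) \<le> 2 * (3 * N) * norm (p - q)"
  proof (rule lipschitz_of_partial_bound)
    show "((\<lambda>p. pd \<gamma> g (dfs_point p)) has_derivative
      (\<lambda>h. \<Sum>i\<in>UNIV. h $ i *\<^sub>R (\<Sum>l\<in>UNIV. e l i p *\<^sub>R pd (l # \<gamma>) g (dfs_point p)))) (at p)" for p
      by (rule has_derivative_pd_dfs_point[OF g U lt de])
    fix i p
    have "norm (e l i p *\<^sub>R pd (l # \<gamma>) g (dfs_point p)) \<le> 1 * N" for l
      unfolding norm_scaleR using trig_atom_bound[OF e] pd_bound[of "l # \<gamma>"] dfs_point_in_S2 lt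
      by (intro mult_mono) auto
    then have "norm (\<Sum>l\<in>UNIV. e l i p *\<^sub>R pd (l # \<gamma>) g (dfs_point p)) \<le> (\<Sum>l\<in>(UNIV::3 set). 1 * N)"
      by (intro sum_norm_le) auto
    then show "norm (\<Sum>l\<in>UNIV. e l i p *\<^sub>R pd (l # \<gamma>) g (dfs_point p)) \<le> 3 * N"
      by simp
  qed
  moreover have "norm (pd \<gamma> g (dfs_point p) - pd \<gamma> g (dfs_point q)) \<le> 6 * N"
    using norm_triangle_ineq4[of "pd \<gamma> g (dfs_point p)" "pd \<gamma> g (dfs_point q)"]
      pd_bound[OF assms dfs_point_in_S2, of p] pd_bound[OF assms dfs_point_in_S2, of q] N_nonneg
    by linarith
  ultimately show ?thesis
    using alpha N_nonneg by (intro le_powr_of_le_min) auto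
qed

lemma dfs_sum_bound:
  assumes "admissible m ts" "m \<le> k"
  shows "norm (dfs_sum g ts p) \<le> real (length ts) * N"
  unfolding dfs_sum_def
proof (rule sum_list_norm_le)
  fix t assume "t \<in> set ts"
  then have t: "length (fst t) \<le> k" "set (snd t) \<subseteq> trig_atoms"
    using assms by (auto simp: admissible_def intro: order_trans)
  have "norm (dfs_term g t p) \<le> 1 * N"
    unfolding dfs_term_def norm_scaleR
    using t by (intro mult_mono atom_prod_bound pd_bound dfs_point_in_S2) auto
  then show "norm (dfs_term g t p) \<le> N" by simp
qed

text \<open>In each term the difference is split into a change of the derivative of
  \<open>g\<close>, costing \<open>6 * N\<close>, and a change of at most \<open>m\<close>
  trigonometric factors, costing \<open>2 * m * N\<close>.\<close>

lemma dfs_sum_holder: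
  assumes "admissible m ts" "m \<le> k"
  shows "norm (dfs_sum g ts p - dfs_sum g ts q)
    \<le> real (length ts) * ((6 + 2 * real m) * N * norm (p - q) powr \<alpha>)"
proof -
  have "norm (\<Sum>t\<leftarrow>ts. dfs_term g t p - dfs_term g t q)
      \<le> real (length ts) * ((6 + 2 * real m) * N * norm (p - q) powr \<alpha>)"
  proof (rule sum_list_norm_le)
    fix t assume "t \<in> set ts"
    then have t: "length (fst t) \<le> k" "length (snd t) \<le> m" "set (snd t) \<subseteq> trig_atoms"
      using assms by (auto simp: admissible_def intro: order_trans)
    let ?A = "\<lambda>p. pd (fst t) g (dfs_point p)" and ?c = "atom_prod (snd t)"
    have "dfs_term g t p - dfs_term g t q = ?c p *\<^sub>R (?A p - ?A q) + (?c p - ?c q) *\<^sub>R ?A q"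
      by (simp add: dfs_term_def algebra_simps)
    then have "norm (dfs_term g t p - dfs_term g t q)
        \<le> \<bar>?c p\<bar> * norm (?A p - ?A q) + \<bar>?c p - ?c q\<bar> * norm (?A q)"
      by (metis norm_scaleR norm_triangle_ineq)
    also have "\<dots> \<le> 1 * (6 * N * norm (p - q) powr \<alpha>)
        + (2 * real (length (snd t)) * norm (p - q) powr \<alpha>) * N"
      using t alpha
      by (intro add_mono mult_mono atom_prod_bound atom_prod_holder pd_dfs_point_holder
          pd_bound dfs_point_in_S2) auto
    also have "\<dots> \<le> 1 * (6 * N * norm (p - q) powr \<alpha>) + (2 * real m * norm (p - q) powr \<alpha>) * N"
      using t N_nonneg by (intro add_mono mult_right_mono mult_left_mono) auto
    finally show "norm (dfs_term g t p - dfs_term g t q) \<le> (6 + 2 * real m) * N * norm (p - q) powr \<alpha>"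
      by (simp add: algebra_simps)
  qed
  then show ?thesis
    by (simp add: dfs_sum_def sum_list_subtractf)
qed

lemma C0_dfs_sum:
  assumes "admissible m ts" "m \<le> k"
  shows "C0 UNIV (dfs_sum g ts)"
  unfolding C0_def
proof
  show "bounded (range (dfs_sum g ts))"
    using dfs_sum_bound[OF assms] by (auto simp: bounded_iff)
  define C where "C = real (length ts) * ((6 + 2 * real m) * N)"
  have C: "0 \<le> C"
    using N_nonneg by (simp add: C_def)
  have hol: "dist (dfs_sum g ts p) (dfs_sum g ts q) \<le> C * dist p q powr \<alpha>" for p q
    using dfs_sum_holder[OF assms, of p q] by (simp add: dist_norm C_def mult.assoc)
  show "uniformly_continuous_on UNIV (dfs_sum g ts)"
    unfolding uniformly_continuous_on_def
  proof (intro allI impI)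
    fix e :: real assume e: "e > 0"
    \<comment> \<open>This makes \<open>C * d powr \<alpha>\<close> equal to
      \<open>C * (e / (C + 1))\<close>, which is below \<open>e\<close>; the added \<open>1\<close>
      covers \<open>C = 0\<close>.\<close>
    define d where "d = (e / (C + 1)) powr (1 / \<alpha>)"
    have "d > 0" using e C by (simp add: d_def)
    moreover have "dist (dfs_sum g ts q) (dfs_sum g ts p) < e" if "dist q p < d" for p q
    proof -
      have "dist q p powr \<alpha> \<le> d powr \<alpha>"
        using that alpha by (intro powr_mono2) auto
      also have "\<dots> = e / (C + 1)"
        using alpha e C by (simp add: d_def powr_powr)
      finally have "C * dist q p powr \<alpha> \<le> C * (e / (C + 1))"
        using C by (intro mult_left_mono)
      also have "\<dots> < e"
        using e C by (simp add: field_simps)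
      finally show ?thesis
        using hol[of q p] by simp
    qed
    ultimately show "\<exists>d>0. \<forall>x\<in>UNIV. \<forall>x'\<in>UNIV. dist x' x < d \<longrightarrow>
        dist (dfs_sum g ts x') (dfs_sum g ts x) < e"
      by blast
  qed
qed

text \<open>Induction on the number \<open>j\<close> of derivatives still available; each one raises
  the order \<open>m\<close> by one and keeps \<open>m + j = k\<close>.\<close>

lemma Ck_dfs_sum:
  assumes "admissible m ts" "m + j = k"
  shows "Ck j UNIV (dfs_sum g ts)"
  using assms
proof (induction j arbitrary: m ts)
  case 0
  then show ?case by (simp add: C0_dfs_sum)
next
  case (Suc j)
  have "Ck j UNIV (partial i (dfs_sum g ts))" for i
  proof -
    obtain ts' where "admissible (Suc m) ts'" "partial i (dfs_sum g ts) = dfs_sum g ts'"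
      using dfs_sum_partial(2)[OF g U _ Suc.prems(1), of i] Suc.prems(2) by auto
    then show ?thesis
      using Suc.IH[of "Suc m" ts'] Suc.prems(2) by simp
  qed
  moreover have "has_partial i (dfs_sum g ts) p" for i p
    using dfs_sum_partial(1)[OF g U _ Suc.prems(1)] Suc.prems(2) by simp
  ultimately show ?case
    using C0_dfs_sum[OF Suc.prems(1)] Suc.prems(2) by simp
qed

lemma Ck_dfs: "Ck k UNIV (dfs g)"
proof -
  have "dfs g = dfs_sum g [([], [])]"
    by (simp add: fun_eq_iff dfs_def dfs_sum_def dfs_term_def)
  then show ?thesis
    using Ck_dfs_sum[of 0 "[([], [])]" k] by (simp add: admissible_def)
qed

lemma D_dfs_bound:
  assumes "mi_order \<beta> \<le> k"
  shows "norm (D \<beta> (dfs g) p) \<le> fact (mi_order \<beta> + 2) / 2 * N"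
proof -
  obtain ts where ts: "admissible (mi_order \<beta>) ts" "2 * length ts \<le> fact (mi_order \<beta> + 2)"
    "D \<beta> (dfs g) = dfs_sum g ts"
    using pd_dfs_eq_dfs_sum[OF g U, of "mi_list \<beta>"] assms by (auto simp: length_mi_list D_def)
  have "real (2 * length ts) \<le> fact (mi_order \<beta> + 2)"
    using ts(2) by (metis of_nat_fact of_nat_le_iff)
  then have "real (length ts) * N \<le> fact (mi_order \<beta> + 2) / 2 * N"
    using N_nonneg by (intro mult_right_mono) auto
  then show ?thesis
    using dfs_sum_bound[OF ts(1) assms, of p] ts(3) by simp
qed

text \<open>At most \<open>fact (k + 2) / 2\<close> terms, each with constant
  \<open>(6 + 2 * k) * N\<close>, give exactly \<open>fact (k + 3) * N\<close>.\<close>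

lemma D_dfs_holder:
  assumes "mi_order \<beta> = k"
  shows "norm (D \<beta> (dfs g) p - D \<beta> (dfs g) q) \<le> fact (k + 3) * N * norm (p - q) powr \<alpha>"
proof -
  obtain ts where ts: "admissible k ts" "2 * length ts \<le> fact (k + 2)"
    "D \<beta> (dfs g) = dfs_sum g ts"
    using pd_dfs_eq_dfs_sum[OF g U, of "mi_list \<beta>"] assms by (auto simp: length_mi_list D_def)
  have "real (2 * length ts) \<le> fact (k + 2)"
    using ts(2) by (metis of_nat_fact of_nat_le_iff)
  then have "real (2 * length ts) * (3 + real k) \<le> fact (k + 2) * (3 + real k)"
    by (intro mult_right_mono) auto
  also have "\<dots> = fact (k + 3)"
    by (simp add: numeral_eq_Suc algebra_simps)
  finally have "(real (2 * length ts) * (3 + real k)) * (N * norm (p - q) powr \<alpha>)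
      \<le> fact (k + 3) * (N * norm (p - q) powr \<alpha>)"
    using N_nonneg by (intro mult_right_mono) auto
  then show ?thesis
    using dfs_sum_holder[OF ts(1), of p q] ts(3) by (simp add: algebra_simps)
qed

lemma holder_quots_dfs_le:
  assumes "x \<in> holder_quots k \<alpha> UNIV (dfs g)"
  shows "x \<le> fact (k + 3) * N"
proof -
  obtain \<beta> p q where "mi_order \<beta> = k" "p \<noteq> q"
    "x = cmod (D \<beta> (dfs g) p - D \<beta> (dfs g) q) / norm (p - q) powr \<alpha>"
    using assms unfolding holder_quots_def by blast
  then show ?thesis
    using D_dfs_holder[of \<beta> p q] by (simp add: divide_le_eq)
qed

end

section \<open>Counting multi-indices and passing to the sphere norm\<close>

lemma mi_order_single: "mi_order (\<lambda>i. if i = a then k else 0) = k"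
  by (simp add: mi_order_def)

text \<open>Guarantees that the real \<open>Sup\<close> in \<open>holder_semi\<close> is taken over
  a nonempty set: a multi-index concentrated in one coordinate has order \<open>k\<close>.\<close>

lemma holder_quots_nonempty:
  assumes "x \<in> S" "y \<in> S" "x \<noteq> y"
  shows "holder_quots k \<alpha> S f \<noteq> {}"
  using assms mi_order_single[of undefined k] by (auto simp: holder_quots_def)

text \<open>In two variables at most \<open>k + 2\<close> multi-indices have order
  \<open>k + 1\<close>, each contributing \<open>fact (k + 3)\<close>. With the induction hypothesis
  this is \<open>(k + 3) * fact (k + 3)\<close>, below \<open>fact (k + 4)\<close>.\<close>

lemma sum_fact_mi_order_le: "(\<Sum>\<beta>\<in>(B k :: (2 \<Rightarrow> nat) set). fact (mi_order \<beta> + 2)) \<le> (fact (k + 3) :: real)"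
proof (induction k)
  case 0
  have "(B 0 :: (2 \<Rightarrow> nat) set) = {\<lambda>_. 0}"
    by (auto simp: B_def mi_order_def fun_eq_iff)
  then show ?case
    by (simp add: mi_order_def numeral_eq_Suc)
next
  case (Suc k)
  let ?L = "{\<beta> :: 2 \<Rightarrow> nat. mi_order \<beta> = Suc k}"
  have split: "B (Suc k) = B k \<union> ?L" "B k \<inter> ?L = {}"
    by (auto simp: B_def)
  have fin: "finite ?L"
    by (rule finite_subset[OF _ finite_B[of "Suc k"]]) (auto simp: B_def)
  \<comment> \<open>For a fixed order, the first entry determines the second.\<close>
  have "inj_on (\<lambda>\<beta>. \<beta> 1) ?L"
  proof (rule inj_onI)
    fix \<beta> \<beta>' :: "2 \<Rightarrow> nat"
    assume "\<beta> \<in> ?L" "\<beta>' \<in> ?L" "\<beta> 1 = \<beta>' 1"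
    then have "\<forall>i. \<beta> i = \<beta>' i"
      by (simp add: mi_order_def sum_2 forall_2)
    then show "\<beta> = \<beta>'" by blast
  qed
  then have "card ?L \<le> card {..Suc k}"
    by (rule card_inj_on_le) (auto simp: mi_order_def sum_2)
  then have card: "real (card ?L) \<le> real k + 2"
    by simp
  have "(\<Sum>\<beta>\<in>(B (Suc k) :: (2 \<Rightarrow> nat) set). fact (mi_order \<beta> + 2)) =
      (\<Sum>\<beta>\<in>B k. fact (mi_order (\<beta> :: 2 \<Rightarrow> nat) + 2)) + (\<Sum>\<beta>\<in>?L. fact (mi_order \<beta> + 2) :: real)"
    unfolding split(1) by (rule sum.union_disjoint[OF finite_B fin split(2)])
  also have "(\<Sum>\<beta>\<in>?L. fact (mi_order \<beta> + 2) :: real) = real (card ?L) * fact (k + 3)"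
    by (simp add: numeral_eq_Suc)
  also have "(\<Sum>\<beta>\<in>B k. fact (mi_order (\<beta> :: 2 \<Rightarrow> nat) + 2)) + real (card ?L) * fact (k + 3)
      \<le> fact (k + 3) + (real k + 2) * fact (k + 3)"
    using Suc card by (intro add_mono mult_right_mono) auto
  also have "\<dots> \<le> (real k + 4) * fact (k + 3)"
    by (simp add: algebra_simps)
  also have "\<dots> = fact (Suc k + 3)"
    by (simp add: numeral_eq_Suc algebra_simps)
  finally show ?case .
qed

lemma S2_axis: "axis i 1 \<in> S2"
  by (simp add: S2_def)

text \<open>A real supremum dominates its members only for sets bounded above; boundedness is
  inherited from \<open>U\<close>. Each of the two parts of the norm lies below their sum because
  the other one is nonnegative.\<close>

lemma is_extension_imp_bounded_extension:
  assumes "0 < \<alpha>" "\<alpha> < 1" and ext: "is_extension k \<alpha> f U g"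
  shows "bounded_extension k \<alpha> U g (holder_norm k \<alpha> S2 g)"
proof
  show "0 < \<alpha>" "\<alpha> < 1" by fact+
  show U: "open U" "S2 \<subseteq> U" and g: "Ck k U g"
    using ext by (auto simp: is_extension_def Ckalpha_def)
  have quots: "bdd_above (holder_quots k \<alpha> S2 g)"
    by (rule bdd_above_mono[of "holder_quots k \<alpha> U g"])
      (use ext in \<open>auto simp: is_extension_def Ckalpha_def holder_quots_def\<close>)
  have bdd: "bdd_above ((\<lambda>\<xi>. cmod (D \<beta> g \<xi>)) ` S2)" if "\<beta> \<in> B k" for \<beta>
  proof -
    have "bounded (D \<beta> g ` U)"
      using Ck_imp_C0[OF Ck_pd[OF g, of "mi_list \<beta>"]] that
      by (simp add: C0_def D_def B_def length_mi_list)
    then show ?thesis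
      using U(2) by (force simp: bounded_iff bdd_above_def)
  qed
  have sup_nonneg: "0 \<le> (SUP \<xi>\<in>S2. cmod (D \<beta> g \<xi>))" if "\<beta> \<in> B k" for \<beta>
    by (rule cSUP_upper2[OF bdd[OF that] S2_axis[of 1]]) simp
  have le_sup_part: "cmod (D \<beta> g \<xi>) \<le> sup_part k S2 g" if "\<beta> \<in> B k" "\<xi> \<in> S2" for \<beta> \<xi>
  proof -
    have "cmod (D \<beta> g \<xi>) \<le> (SUP \<xi>\<in>S2. cmod (D \<beta> g \<xi>))"
      by (rule cSUP_upper[OF that(2) bdd[OF that(1)]])
    also have "\<dots> \<le> sup_part k S2 g"
      unfolding sup_part_def
      using that(1) sup_nonneg finite_B by (intro member_le_sum) auto
    finally show ?thesis .
  qed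
  have sup_part_nonneg: "0 \<le> sup_part k S2 g"
    unfolding sup_part_def by (intro sum_nonneg sup_nonneg)
  \<comment> \<open>Two distinct points of the sphere provide a nonnegative quotient, so the
    supremum is nonnegative.\<close>
  have "axis 1 1 \<noteq> (axis 2 1 :: real^3)"
    by (simp add: axis_eq_axis)
  then obtain x where "x \<in> holder_quots k \<alpha> S2 g"
    using holder_quots_nonempty[OF S2_axis S2_axis] by blast
  moreover from this have "0 \<le> x"
    by (auto simp: holder_quots_def)
  ultimately have semi_nonneg: "0 \<le> holder_semi k \<alpha> S2 g"
    unfolding holder_semi_def using quots by (meson cSup_upper order_trans)
  fix \<gamma> :: "3 list" and \<xi> assume \<xi>: "\<xi> \<in> S2"
  show "norm (pd \<gamma> g \<xi>) \<le> holder_norm k \<alpha> S2 g" if "length \<gamma> \<le> k"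
    using pd_eq_D[OF g U(1) that, of \<xi>] le_sup_part[of "count (mset \<gamma>)" \<xi>] \<xi> U(2) semi_nonneg that
    by (auto simp: holder_norm_def B_def)
  fix \<eta> assume \<eta>: "\<eta> \<in> S2"
  show "norm (pd \<gamma> g \<xi> - pd \<gamma> g \<eta>) \<le> holder_norm k \<alpha> S2 g * norm (\<xi> - \<eta>) powr \<alpha>" if "length \<gamma> = k"
  proof (cases "\<xi> = \<eta>")
    case False
    let ?\<beta> = "count (mset \<gamma>)"
    have eq: "pd \<gamma> g \<xi> = D ?\<beta> g \<xi>" "pd \<gamma> g \<eta> = D ?\<beta> g \<eta>" "mi_order ?\<beta> = k"
      using pd_eq_D[OF g U(1), of \<gamma>] that \<xi> \<eta> U(2) by auto
    then have "cmod (pd \<gamma> g \<xi> - pd \<gamma> g \<eta>) / norm (\<xi> - \<eta>) powr \<alpha> \<in> holder_quots k \<alpha> S2 g"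
      unfolding holder_quots_def using \<xi> \<eta> False by auto
    then have "cmod (pd \<gamma> g \<xi> - pd \<gamma> g \<eta>) / norm (\<xi> - \<eta>) powr \<alpha> \<le> holder_norm k \<alpha> S2 g"
      using cSup_upper[OF _ quots] sup_part_nonneg
      by (fastforce simp: holder_norm_def holder_semi_def)
    then show ?thesis
      using False by (simp add: divide_le_eq)
  qed simp
qed

text \<open>Carries a bound valid for every extension over to the infimum defining
  \<open>sphere_norm\<close>.\<close>

lemma le_mult_cInf:
  fixes c y :: real
  assumes "S \<noteq> {}" "0 < c" "\<And>x. x \<in> S \<Longrightarrow> y \<le> c * x"
  shows "y \<le> c * Inf S"
proof -
  have "y / c \<le> Inf S"
    using assms by (intro cInf_greatest) (auto simp: divide_le_eq mult.commute)
  then show ?thesis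
    using assms(2) by (simp add: divide_le_eq mult.commute)
qed

lemma biperiodic_dfs: "biperiodic (dfs f)"
  by (simp add: biperiodic_def dfs_def dfs_phi_def axis_def)

theorem theorem4p5:
  fixes k :: nat and \<alpha> :: real and f :: "real^3 \<Rightarrow> complex"
  assumes "0 < \<alpha>" and "\<alpha> < 1" and "sphere_Ckalpha k \<alpha> f"
  shows "torus_Ckalpha k \<alpha> (dfs f)
    \<and> torus_semi k \<alpha> (dfs f) \<le> fact (k + 3) * sphere_norm k \<alpha> f
    \<and> torus_norm k \<alpha> (dfs f) \<le> 7 / 4 * fact (k + 3) * sphere_norm k \<alpha> f"
proof -
  let ?F = "fact (k + 3) :: real"
  have step: "torus_Ckalpha k \<alpha> (dfs f) \<and> torus_semi k \<alpha> (dfs f) \<le> ?F * holder_norm k \<alpha> S2 g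
      \<and> torus_norm k \<alpha> (dfs f) \<le> 7 / 4 * ?F * holder_norm k \<alpha> S2 g"
    if ext: "is_extension k \<alpha> f U g" for U g
  proof -
    define N where "N = holder_norm k \<alpha> S2 g"
    interpret bounded_extension k \<alpha> U g N
      unfolding N_def by (rule is_extension_imp_bounded_extension[OF assms(1,2) ext])
    \<comment> \<open>\<open>dfs\<close> evaluates its argument only on the sphere, where
      \<open>g\<close> agrees with \<open>f\<close>.\<close>
    have fg: "dfs f = dfs g"
      using ext dfs_point_in_S2 by (auto simp: dfs_def is_extension_def)
    have semi: "holder_semi k \<alpha> UNIV (dfs g) \<le> ?F * N"
      unfolding holder_semi_def
      by (rule cSup_least) (use holder_quots_nonempty[of 0 UNIV "axis 1 1"] holder_quots_dfs_le in auto)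
    have "sup_part k UNIV (dfs g) \<le> (\<Sum>\<beta>\<in>(B k :: (2 \<Rightarrow> nat) set). fact (mi_order \<beta> + 2) / 2 * N)"
      unfolding sup_part_def using D_dfs_bound by (intro sum_mono cSUP_least) (auto simp: B_def)
    also have "\<dots> = (\<Sum>\<beta>\<in>(B k :: (2 \<Rightarrow> nat) set). fact (mi_order \<beta> + 2)) * (N / 2)"
      by (simp add: sum_distrib_right)
    also have "\<dots> \<le> ?F * (N / 2)"
      using sum_fact_mi_order_le N_nonneg by (intro mult_right_mono) auto
    \<comment> \<open>The suprema contribute \<open>1 / 2\<close> and the seminorm \<open>1\<close>;
      the sum \<open>3 / 2\<close> is below \<open>7 / 4\<close>.\<close>
    finally have "holder_norm k \<alpha> UNIV (dfs g) \<le> 3 / 2 * (?F * N)"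
      using semi by (simp add: holder_norm_def)
    also have "\<dots> \<le> 7 / 4 * (?F * N)"
      using N_nonneg by (intro mult_right_mono) auto
    finally have "holder_norm k \<alpha> UNIV (dfs g) \<le> 7 / 4 * ?F * N"
      by simp
    moreover have "bdd_above (holder_quots k \<alpha> UNIV (dfs g))"
      using holder_quots_dfs_le by (auto simp: bdd_above_def)
    ultimately show ?thesis
      using semi Ck_dfs biperiodic_dfs
      by (simp add: torus_Ckalpha_def torus_semi_def torus_norm_def Ckalpha_def fg N_def)
  qed
  have "{holder_norm k \<alpha> S2 g | U g. is_extension k \<alpha> f U g} \<noteq> {}"
    using assms(3) by (auto simp: sphere_Ckalpha_def)
  then have "torus_semi k \<alpha> (dfs f) \<le> ?F * sphere_norm k \<alpha> f"
    "torus_norm k \<alpha> (dfs f) \<le> 7 / 4 * ?F * sphere_norm k \<alpha> f"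
    unfolding sphere_norm_def using step by (auto intro!: le_mult_cInf)
  then show ?thesis
    using assms(3) step by (auto simp: sphere_Ckalpha_def)
qed

end
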